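(* Any torsion free hyperbolic group is principal.
   Context: Hyperbolic means word-hyperbolic in the sense of Gromov. For a group $\pi$, let $\mathcal D$ be the smallest set of subgroups of $\pi\times\pi$ which contains the trivial subgroup and the diagonal $\Delta=\{(a,a):a\in\pi\}$ and is closed under conjugation and finite intersections. (Its nontrivial members have the form $\{(a,bab^{-1}):a\in Z(S)\}$ with $b\in\pi$, $S\subset\pi$ finite and $Z(S)$ the centraliser of $S$ in $\pi$.) The group $\pi$ is called principal if for any two subgroups $H,H'\in\mathcal D$ the index $[H:H\cap H']$ is either $1$ or infinite. For torsion free $\pi$ this is equivalent to: for any two finite subsets $S,S'\subset\pi$ the index $[Z(S):Z(S\cup S')]$ is either $1$ or infinite. *)

theory Defs
  imports Complex_Main "HOL-Algebra.Algebra"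
begin

section \<open>Gromov hyperbolicity\<close>

definition gromov_product :: "('a \<Rightarrow> 'a \<Rightarrow> real) \<Rightarrow> 'a \<Rightarrow> 'a \<Rightarrow> 'a \<Rightarrow> real" where
  "gromov_product d p x y = (d x p + d y p - d x y) / 2"

definition gromov_hyperbolic :: "'a set \<Rightarrow> ('a \<Rightarrow> 'a \<Rightarrow> real) \<Rightarrow> bool" where
  "gromov_hyperbolic M d \<longleftrightarrow>
     (\<exists>\<delta>\<ge>0. \<forall>p\<in>M. \<forall>x\<in>M. \<forall>y\<in>M. \<forall>z\<in>M.
        gromov_product d p x z \<ge> min (gromov_product d p x y) (gromov_product d p y z) - \<delta>)"

text \<open>
  The least length of a word in the letters \<open>S\<close> and their inverses that represents \<open>g\<close>.
  It is only meaningful for \<open>g\<close> in the subgroup generated by \<open>S\<close>.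
\<close>

definition word_length :: "('a, 'b) monoid_scheme \<Rightarrow> 'a set \<Rightarrow> 'a \<Rightarrow> nat" where
  "word_length G S g =
     (LEAST n. \<exists>w. length w = n \<and> set w \<subseteq> S \<union> m_inv G ` S \<and>
                   foldr (\<otimes>\<^bsub>G\<^esub>) w \<one>\<^bsub>G\<^esub> = g)"

definition word_dist :: "('a, 'b) monoid_scheme \<Rightarrow> 'a set \<Rightarrow> 'a \<Rightarrow> 'a \<Rightarrow> real" where
  "word_dist G S g h = real (word_length G S (inv\<^bsub>G\<^esub> g \<otimes>\<^bsub>G\<^esub> h))"

text \<open>
  Whether the word metric is Gromov hyperbolic does not depend on the finite generating set,
  so some finite generating set is required to have this property.
\<close>

definition hyperbolic_group :: "('a, 'b) monoid_scheme \<Rightarrow> bool" where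
  "hyperbolic_group G \<longleftrightarrow>
     group G \<and>
     (\<exists>S. finite S \<and> S \<subseteq> carrier G \<and> generate G S = carrier G \<and>
          gromov_hyperbolic (carrier G) (word_dist G S))"

definition torsion_free :: "('a, 'b) monoid_scheme \<Rightarrow> bool" where
  "torsion_free G \<longleftrightarrow>
     (\<forall>x\<in>carrier G. \<forall>n::nat. n > 0 \<longrightarrow> x [^]\<^bsub>G\<^esub> n = \<one>\<^bsub>G\<^esub> \<longrightarrow> x = \<one>\<^bsub>G\<^esub>)"


section \<open>Principal groups\<close>

definition diagonal :: "('a, 'b) monoid_scheme \<Rightarrow> ('a \<times> 'a) set" where
  "diagonal G = (\<lambda>a. (a, a)) ` carrier G"

text \<open>
  Finite intersections are intersections of nonempty finite families: the empty intersection,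
  the whole of \<open>G \<times>\<times> G\<close>, is not put into the family.
\<close>

inductive_set diagonal_family :: "('a, 'b) monoid_scheme \<Rightarrow> ('a \<times> 'a) set set"
  for G :: "('a, 'b) monoid_scheme" where
  trivial: "{\<one>\<^bsub>G \<times>\<times> G\<^esub>} \<in> diagonal_family G"
| diag: "diagonal G \<in> diagonal_family G"
| conj: "\<lbrakk>H \<in> diagonal_family G; g \<in> carrier (G \<times>\<times> G)\<rbrakk> \<Longrightarrow>
     g <#\<^bsub>G \<times>\<times> G\<^esub> H #>\<^bsub>G \<times>\<times> G\<^esub> inv\<^bsub>G \<times>\<times> G\<^esub> g \<in> diagonal_family G"
| inter: "\<lbrakk>H \<in> diagonal_family G; H' \<in> diagonal_family G\<rbrakk> \<Longrightarrow> H \<inter> H' \<in> diagonal_family G"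

lemma diagonal_family_subgroup:
  assumes "group G" "H \<in> diagonal_family G"
  shows "subgroup H (G \<times>\<times> G)"
proof -
  interpret G: group G by fact
  interpret GG: group "G \<times>\<times> G" using assms(1) by (simp add: DirProd_group)
  show ?thesis using assms(2)
  proof induction
    case trivial
    show ?case by (rule GG.triv_subgroup)
  next
    case diag
    show ?case
      by (rule GG.subgroupI) (auto simp: diagonal_def inv_DirProd assms(1))
  next
    case (conj H g)
    then show ?case by (intro GG.subgroup_conjugation_is_surj2)
  next
    case (inter H H')
    then show ?case by (simp add: GG.subgroups_Inter_pair)
  qed
qed

text \<open>
  The index \<open>[H : H \<inter> H']\<close> is the number of cosets of \<open>H \<inter> H'\<close> in the group \<open>H\<close>;
  an infinite index is stated separately, as \<open>card\<close> is \<open>0\<close> on infinite sets.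
\<close>

definition principal_group :: "('a, 'b) monoid_scheme \<Rightarrow> bool" where
  "principal_group G \<longleftrightarrow>
     group G \<and>
     (\<forall>H\<in>diagonal_family G. \<forall>H'\<in>diagonal_family G.
        card (rcosets\<^bsub>(G \<times>\<times> G)\<lparr>carrier := H\<rparr>\<^esub> (H \<inter> H')) = 1 \<or>
        infinite (rcosets\<^bsub>(G \<times>\<times> G)\<lparr>carrier := H\<rparr>\<^esub> (H \<inter> H')))"

end

theory Submission
  imports Defs
begin

text \<open>
  In a torsion-free hyperbolic group roots are unique: \<open>x\<^sup>n = y\<^sup>n\<close> with \<open>n > 0\<close> forces
  \<open>x = y\<close>. Hence every member of the diagonal family is closed under taking roots, and a
  finite index \<open>[H : H \<inter> H']\<close> gives \<open>H \<subseteq> H'\<close>, since each element of \<open>H\<close> has a positive power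
  in \<open>H \<inter> H'\<close>.

  For unique roots, let \<open>g = x\<^sup>n \<noteq> 1\<close>. A counting argument along a long geodesic shows that
  \<open>\<bar>g\<^sup>i\<bar>\<close> cannot grow logarithmically, so \<open>\<bar>u\<^sup>2\<bar> > \<bar>u\<bar> + 4\<delta>\<close> for some power \<open>u\<close> of \<open>g\<close>. The
  four-point condition then shows that every coset of \<open>\<langle>u\<rangle>\<close> in the centraliser \<open>Z(u)\<close> contains
  an element shorter than \<open>u\<close>. So \<open>\<langle>u\<rangle>\<close> is a central subgroup of finite index in \<open>Z(u)\<close>, and by
  transfer \<open>Z(u)\<close> is abelian. As \<open>x\<close> and \<open>y\<close> lie in \<open>Z(u)\<close>, \<open>(x y\<^sup>-\<^sup>1)\<^sup>n = 1\<close>.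
\<close>

section \<open>Torsion-free groups with a central cyclic subgroup of finite index\<close>

lemma torsion_freeD:
  "\<lbrakk>torsion_free G; x \<in> carrier G; x [^]\<^bsub>G\<^esub> (n::nat) = \<one>\<^bsub>G\<^esub>; n > 0\<rbrakk> \<Longrightarrow> x = \<one>\<^bsub>G\<^esub>"
  unfolding torsion_free_def by blast

context group
begin

lemma mult_inv_cancel:
  assumes "x \<in> carrier G" "y \<in> carrier G"
  shows "x \<otimes> (inv x \<otimes> y) = y" "inv x \<otimes> (x \<otimes> y) = y"
  using assms by (simp_all flip: m_assoc)

text \<open>Lets commutation with \<open>a\<close> pass to inverses and integer powers by subgroup
  closure. The centraliser of a power later serves as the group on which the transfer argument
  runs.\<close>

lemma subgroup_centralizer:
  assumes a: "a \<in> carrier G"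
  shows "subgroup {x \<in> carrier G. x \<otimes> a = a \<otimes> x} G"
proof (rule subgroupI)
  show "{x \<in> carrier G. x \<otimes> a = a \<otimes> x} \<noteq> {}"
    using a by (intro ex_in_conv[THEN iffD1] exI[of _ \<one>]) auto
next
  fix x assume "x \<in> {x \<in> carrier G. x \<otimes> a = a \<otimes> x}"
  then have x: "x \<in> carrier G" "x \<otimes> a = a \<otimes> x" by auto
  then have "a \<otimes> inv x = inv x \<otimes> a"
    using a by (metis inv_closed inv_solve_left inv_solve_right m_assoc m_closed)
  then show "inv x \<in> {x \<in> carrier G. x \<otimes> a = a \<otimes> x}" using x a by simp
next
  fix x y assume "x \<in> {x \<in> carrier G. x \<otimes> a = a \<otimes> x}" "y \<in> {x \<in> carrier G. x \<otimes> a = a \<otimes> x}"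
  then have x: "x \<in> carrier G" "x \<otimes> a = a \<otimes> x" and y: "y \<in> carrier G" "y \<otimes> a = a \<otimes> y" by auto
  have "x \<otimes> y \<otimes> a = x \<otimes> a \<otimes> y" using x(1) y a by (simp add: m_assoc)
  also have "\<dots> = a \<otimes> (x \<otimes> y)" using x y(1) a by (simp add: m_assoc)
  finally show "x \<otimes> y \<in> {x \<in> carrier G. x \<otimes> a = a \<otimes> x}" using x y by simp
qed blast

lemma int_pow_commute:
  assumes "x \<in> carrier G" "a \<in> carrier G" "x \<otimes> a = a \<otimes> x"
  shows "x [^] (j::int) \<otimes> a = a \<otimes> x [^] j"
  using subgroup_int_pow_closed[OF subgroup_centralizer[OF assms(2)], of x j] assms by simp

lemma torsion_free_inj_nat_pow:
  assumes tf: "torsion_free G" and x: "x \<in> carrier G" "x \<noteq> \<one>"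
  shows "inj (\<lambda>n::nat. x [^] n)"
proof (rule injI)
  fix m n :: nat assume "x [^] m = x [^] n"
  \<comment> \<open>Natural subtraction truncates, so at least one equation is trivial; taking both
    avoids fixing an order of \<open>m\<close> and \<open>n\<close>.\<close>
  then have "x [^] (m - n) = \<one>" "x [^] (n - m) = \<one>"
    using pow_eq_div2[OF x(1)] by metis+
  then have "\<not> m - n > 0" "\<not> n - m > 0" using torsion_freeD[OF tf x(1)] x(2) by blast+
  then show "m = n" by simp
qed

lemma torsion_free_int_pow_eq_one:
  assumes tf: "torsion_free G" and x: "x \<in> carrier G" "x \<noteq> \<one>" and "x [^] (j::int) = \<one>"
  shows "j = 0"
proof (cases j)
  case (nonneg n)
  then have "x [^] n = \<one>" using assms(4) by (simp only: int_pow_int)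
  then show ?thesis using torsion_freeD[OF tf x(1)] x(2) nonneg by fastforce
next
  case (neg n)
  then have "inv (x [^] Suc n) = \<one>" using assms(4) int_pow_neg_int[OF x(1), of "Suc n"] by metis
  then have "x [^] Suc n = \<one>" using x(1) inv_eq_1_iff nat_pow_closed by blast
  then show ?thesis using torsion_freeD[OF tf x(1)] x(2) by blast
qed

text \<open>
  The sum \<open>\<phi>\<close> below is the transfer homomorphism into the central cyclic subgroup; it is
  injective because the group is torsion-free.
\<close>

lemma torsion_free_central_cyclic_finite_index_comm:
  assumes tf: "torsion_free G" and u: "u \<in> carrier G" "u \<noteq> \<one>"
    and central: "\<And>x. x \<in> carrier G \<Longrightarrow> u \<otimes> x = x \<otimes> u"
    and F: "finite F" "F \<subseteq> carrier G"
    and cover: "\<And>x. x \<in> carrier G \<Longrightarrow> \<exists>f\<in>F. \<exists>j::int. x = f \<otimes> u [^] j"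
    and xy: "x \<in> carrier G" "y \<in> carrier G"
  shows "x \<otimes> y = y \<otimes> x"
proof -
  \<comment> \<open>\<open>\<sigma> x\<close> represents the left coset of \<open>x\<close> modulo
    the powers of \<open>u\<close>, and \<open>e x\<close> is the remaining exponent, unique because
    \<open>u\<close> has infinite order.\<close>
  define \<sigma> where "\<sigma> x = (SOME f. f \<in> F \<and> (\<exists>j::int. x = f \<otimes> u [^] j))" for x
  define e where "e x = (THE j::int. x = \<sigma> x \<otimes> u [^] j)" for x
  have inj: "i = j" if "u [^] i = u [^] j" for i j :: int
    using torsion_free_int_pow_eq_one[OF tf u, of "i - j"] that u by (simp add: int_pow_diff)
  have \<sigma>: "\<sigma> x \<in> F \<and> (\<exists>j::int. x = \<sigma> x \<otimes> u [^] j)" if "x \<in> carrier G" for x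
    unfolding \<sigma>_def by (rule someI_ex) (use cover[OF that] in blast)
  have \<sigma>G: "\<sigma> x \<in> carrier G" if "x \<in> carrier G" for x using \<sigma>[OF that] F by blast
  have e_unique: "e x = j" if x: "x \<in> carrier G" and j: "x = \<sigma> x \<otimes> u [^] j" for x j
    unfolding e_def
  proof (rule the_equality)
    fix i :: int assume i: "x = \<sigma> x \<otimes> u [^] i"
    have "\<sigma> x \<otimes> u [^] i = \<sigma> x \<otimes> u [^] j" using i j by (rule trans[OF sym])
    then have "u [^] i = u [^] j" using \<sigma>G[OF x] u by simp
    then show "i = j" by (rule inj)
  qed (rule j)
  have e: "x = \<sigma> x \<otimes> u [^] e x" if x: "x \<in> carrier G" for x
  proof -
    obtain j :: int where j: "x = \<sigma> x \<otimes> u [^] j" using \<sigma>[OF x] by blast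
    show ?thesis unfolding e_unique[OF x j] by (rule j)
  qed
  have shift: "(x \<otimes> u [^] k = f \<otimes> u [^] j) = (x = f \<otimes> u [^] (j - k))"
    if "x \<in> carrier G" "f \<in> carrier G" for x f and j k :: int
  proof -
    have "f \<otimes> u [^] (j - k) = f \<otimes> u [^] j \<otimes> inv (u [^] k)"
      using that u by (simp add: int_pow_diff m_assoc)
    then show ?thesis using that u inv_solve_right[of x "f \<otimes> u [^] j" "u [^] k"] by auto
  qed
  have \<sigma>_shift: "\<sigma> (x \<otimes> u [^] k) = \<sigma> x" if x: "x \<in> carrier G" for x and k :: int
  proof -
    \<comment> \<open>The predicate under \<open>SOME\<close> depends only on the coset, so the same
      representative is chosen.\<close>
    have "(\<exists>j::int. x \<otimes> u [^] k = f \<otimes> u [^] j) = (\<exists>j::int. x = f \<otimes> u [^] j)" if "f \<in> F" for f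
    proof -
      have "f \<in> carrier G" using that F by blast
      then show ?thesis using shift[OF x] by (metis diff_add_cancel add_diff_cancel)
    qed
    then show ?thesis unfolding \<sigma>_def by metis
  qed
  have e_shift: "e (x \<otimes> u [^] k) = e x + k" if x: "x \<in> carrier G" for x and k :: int
  proof (rule e_unique)
    have "\<sigma> x \<otimes> u [^] (e x + k) = \<sigma> x \<otimes> u [^] e x \<otimes> u [^] k"
      using \<sigma>G[OF x] u by (simp add: int_pow_mult m_assoc)
    then show "x \<otimes> u [^] k = \<sigma> (x \<otimes> u [^] k) \<otimes> u [^] (e x + k)"
      unfolding \<sigma>_shift[OF x] e[OF x, symmetric] by (rule sym)
  qed (use x u in simp)
  define T where "T = \<sigma> ` carrier G"
  have T: "finite T" "T \<subseteq> carrier G" "T \<noteq> {}"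
    using \<sigma> F finite_subset[of T F] unfolding T_def by auto
  have \<sigma>T: "\<sigma> t = t" if t: "t \<in> T" for t
  proof -
    obtain x where x: "x \<in> carrier G" "t = \<sigma> x" using t unfolding T_def by blast
    have "\<sigma> (\<sigma> x \<otimes> u [^] e x) = \<sigma> (\<sigma> x)" by (rule \<sigma>_shift[OF \<sigma>G[OF x(1)]])
    then show ?thesis unfolding e[OF x(1), symmetric] x(2) by (rule sym)
  qed
  have eT: "e t = 0" if "t \<in> T" for t
    by (rule e_unique) (use that T \<sigma>T in auto)
  define \<phi> where "\<phi> x = (\<Sum>t\<in>T. e (x \<otimes> t))" for x
  have \<phi>_mult: "\<phi> (x \<otimes> y) = \<phi> x + \<phi> y" if x: "x \<in> carrier G" and y: "y \<in> carrier G" for x y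
  proof -
    \<comment> \<open>Left multiplication by \<open>y\<close> permutes the left cosets, hence the
      transversal \<open>T\<close>; reindexing along this permutation makes \<open>\<phi>\<close>
      additive.\<close>
    let ?f = "\<lambda>t. \<sigma> (y \<otimes> t)"
    have "inj_on ?f T"
    proof (rule inj_onI)
      fix s t assume st: "s \<in> T" "t \<in> T" and eq: "?f s = ?f t"
      have sG: "s \<in> carrier G" and tG: "t \<in> carrier G" using st T by auto
      have untwist: "z \<otimes> u [^] (- e z) = \<sigma> z" if "z \<in> carrier G" for z
      proof -
        have "z \<otimes> u [^] (- e z) = \<sigma> z \<otimes> u [^] (0::int)"
          unfolding shift[OF that \<sigma>G[OF that]] by (simp flip: e[OF that])
        then show ?thesis using \<sigma>G[OF that] by simp
      qed
      have "y \<otimes> s \<otimes> u [^] (- e (y \<otimes> s)) = y \<otimes> t \<otimes> u [^] (- e (y \<otimes> t))"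
        using untwist[of "y \<otimes> s"] untwist[of "y \<otimes> t"] eq y sG tG by simp
      then have "s \<otimes> u [^] (- e (y \<otimes> s)) = t \<otimes> u [^] (- e (y \<otimes> t))"
        using y sG tG u by (simp add: m_assoc)
      then have "\<sigma> s = \<sigma> t" using \<sigma>_shift sG tG by metis
      then show "s = t" using \<sigma>T st by simp
    qed
    moreover have "?f ` T \<subseteq> T" using T y unfolding T_def by blast
    ultimately have bij: "bij_betw ?f T T" using T by (simp add: bij_betw_def endo_inj_surj)
    have "e (x \<otimes> y \<otimes> t) = e (x \<otimes> ?f t) + e (y \<otimes> t)" if "t \<in> T" for t
    proof -
      have t: "t \<in> carrier G" using that T by blast
      have "x \<otimes> y \<otimes> t = x \<otimes> (?f t \<otimes> u [^] e (y \<otimes> t))"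
        using x y t by (simp add: m_assoc flip: e[of "y \<otimes> t"])
      also have "\<dots> = x \<otimes> ?f t \<otimes> u [^] e (y \<otimes> t)" using x y t u \<sigma>G by (simp add: m_assoc)
      finally show ?thesis using e_shift[of "x \<otimes> ?f t"] x y t \<sigma>G by simp
    qed
    then have "\<phi> (x \<otimes> y) = (\<Sum>t\<in>T. e (x \<otimes> ?f t)) + \<phi> y"
      by (simp add: \<phi>_def sum.distrib)
    also have "(\<Sum>t\<in>T. e (x \<otimes> ?f t)) = \<phi> x"
      unfolding \<phi>_def by (rule sum.reindex_bij_betw[OF bij])
    finally show ?thesis .
  qed
  have \<phi>_one: "\<phi> \<one> = 0" using \<phi>_mult[of \<one> \<one>] by simp
  have \<phi>_pow: "\<phi> (x [^] n) = int n * \<phi> x" if "x \<in> carrier G" for x and n :: nat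
    using that by (induction n) (simp_all add: \<phi>_one \<phi>_mult algebra_simps)
  have \<phi>_u: "\<phi> (u [^] j) = j * card T" for j :: int
  proof -
    \<comment> \<open>Centrality moves \<open>u [^] j\<close> to the right of \<open>t\<close>,
      where it adds \<open>j\<close> to the exponent 0 of \<open>t\<close>.\<close>
    have "e (u [^] j \<otimes> t) = j" if "t \<in> T" for t
      using e_shift[of t j] eT[OF that] int_pow_commute[OF u(1) _ central] that T
      by (metis add_0 subsetD)
    then show ?thesis by (simp add: \<phi>_def)
  qed
  have ker: "x = \<one>" if x: "x \<in> carrier G" and 0: "\<phi> x = 0" for x
  proof -
    \<comment> \<open>Pigeonhole: two powers of \<open>x\<close> share a coset, so some positive
      power of \<open>x\<close> is a power of \<open>u\<close>. There \<open>\<phi>\<close> is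
      multiplication of the exponent by \<open>card T > 0\<close>, so \<open>\<phi> x = 0\<close>
      makes that power trivial.\<close>
    have "range (\<lambda>n::nat. \<sigma> (x [^] n)) \<subseteq> F" using \<sigma> x by blast
    then have "finite (range (\<lambda>n::nat. \<sigma> (x [^] n)))" using F finite_subset by blast
    then have "\<not> inj (\<lambda>n::nat. \<sigma> (x [^] n))" using range_inj_infinite by blast
    then obtain m n :: nat where mn: "m < n" and eq: "\<sigma> (x [^] m) = \<sigma> (x [^] n)"
      unfolding inj_def by (metis nat_neq_iff)
    let ?a = "e (x [^] m)" and ?b = "e (x [^] n)" and ?f = "\<sigma> (x [^] n)"
    have f: "?f \<in> carrier G" using \<sigma>G x by simp
    have "x [^] n = ?f \<otimes> u [^] ?b" "x [^] m = ?f \<otimes> u [^] ?a"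
      using e[of "x [^] n"] e[of "x [^] m", unfolded eq] x by blast+
    moreover have "?f \<otimes> u [^] ?b = ?f \<otimes> u [^] ?a \<otimes> u [^] (?b - ?a)"
      using f u int_pow_mult[of u ?a "?b - ?a"] by (simp add: m_assoc)
    moreover have "x [^] n = x [^] m \<otimes> x [^] (n - m)"
      using nat_pow_mult[OF x, of m "n - m"] mn by simp
    ultimately have "x [^] m \<otimes> x [^] (n - m) = x [^] m \<otimes> u [^] (?b - ?a)" by simp
    then have pow: "x [^] (n - m) = u [^] (?b - ?a)" using x u by simp
    have "(?b - ?a) * card T = 0"
      unfolding \<phi>_u[symmetric] pow[symmetric] \<phi>_pow[OF x] 0 by simp
    then have "?b - ?a = 0" using T by simp
    then have "x [^] (n - m) = \<one>" using pow by simp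
    then show ?thesis using torsion_freeD[OF tf x] mn by simp
  qed
  \<comment> \<open>This is a commutator, so it is killed by the homomorphism \<open>\<phi>\<close>
    into the abelian group of integers.\<close>
  define z where "z = (x \<otimes> y) \<otimes> inv (y \<otimes> x)"
  have z: "z \<in> carrier G" "z \<otimes> (y \<otimes> x) = x \<otimes> y"
    using xy by (simp_all add: z_def m_assoc[of "x \<otimes> y"])
  then have "\<phi> z + \<phi> (y \<otimes> x) = \<phi> (x \<otimes> y)" using \<phi>_mult[of z "y \<otimes> x"] xy by simp
  then have "z = \<one>" using ker z \<phi>_mult xy by simp
  then show ?thesis using z xy by simp
qed

end

section \<open>Root-closed subgroups\<close>

lemma nat_pow_DirProd:
  "(a, b) [^]\<^bsub>G \<times>\<times> H\<^esub> (n::nat) = (a [^]\<^bsub>G\<^esub> n, b [^]\<^bsub>H\<^esub> n)"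
  by (induction n) simp_all

context group
begin

lemma mem_conjugate_iff:
  assumes "H \<subseteq> carrier G" "g \<in> carrier G" "x \<in> carrier G"
  shows "x \<in> g <# H #> inv g \<longleftrightarrow> inv g \<otimes> x \<otimes> g \<in> H"
proof
  assume "x \<in> g <# H #> inv g"
  then obtain h where h: "h \<in> H" "x = g \<otimes> h \<otimes> inv g" by (auto simp: l_coset_def r_coset_def)
  then have "h \<in> carrier G" using assms by auto
  then have "inv g \<otimes> x \<otimes> g = h" using assms h by (simp add: m_assoc mult_inv_cancel)
  then show "inv g \<otimes> x \<otimes> g \<in> H" using h by simp
next
  assume h: "inv g \<otimes> x \<otimes> g \<in> H"
  have "x = g \<otimes> (inv g \<otimes> x \<otimes> g) \<otimes> inv g" using assms by (simp add: m_assoc mult_inv_cancel)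
  then show "x \<in> g <# H #> inv g" using h unfolding l_coset_def r_coset_def by blast
qed

lemma nat_pow_conjugate:
  assumes "g \<in> carrier G" "x \<in> carrier G"
  shows "(inv g \<otimes> x \<otimes> g) [^] (n::nat) = inv g \<otimes> x [^] n \<otimes> g"
proof (induction n)
  case (Suc n)
  then show ?case using assms by (simp add: m_assoc mult_inv_cancel)
qed (use assms in simp)

text \<open>Pigeonhole on the cosets of the powers of \<open>x\<close>: two distinct powers share a
  coset of \<open>K\<close>, and their quotient is a positive power lying in
  \<open>K\<close>.\<close>

lemma nat_pow_mem_of_finite_index:
  assumes H: "subgroup H G" and K: "subgroup K G" "K \<subseteq> H" and x: "x \<in> H"
    and fin: "finite (rcosets\<^bsub>G\<lparr>carrier := H\<rparr>\<^esub> K)"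
  shows "\<exists>n::nat. n > 0 \<and> x [^] n \<in> K"
proof -
  have xG: "x \<in> carrier G" by (rule subgroup.mem_carrier[OF H x])
  have pow: "x [^] (n::nat) \<in> H" for n
    using subgroup_int_pow_closed[OF H x, of "int n"] by (simp add: int_pow_int)
  have "range (\<lambda>n::nat. K #> x [^] n) \<subseteq> rcosets\<^bsub>G\<lparr>carrier := H\<rparr>\<^esub> K"
    using pow by (auto simp: RCOSETS_def r_coset_def)
  then have "finite (range (\<lambda>n::nat. K #> x [^] n))" using fin finite_subset by blast
  then have "\<not> inj (\<lambda>n::nat. K #> x [^] n)" using range_inj_infinite by blast
  then obtain m n :: nat where mn: "m < n" and eq: "K #> x [^] m = K #> x [^] n"
    unfolding inj_def by (metis nat_neq_iff)
  have "x [^] n \<in> K #> x [^] m" using rcos_self[of "x [^] n" K] eq K xG by simp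
  then obtain k where k: "k \<in> K" "x [^] n = k \<otimes> x [^] m" by (auto simp: r_coset_def)
  moreover have "x [^] n = x [^] (n - m) \<otimes> x [^] m"
    using nat_pow_mult[OF xG, of "n - m" m] mn by simp
  ultimately have "x [^] (n - m) = k"
    using xG subgroup.mem_carrier[OF K(1)] by (metis nat_pow_closed r_cancel)
  then show ?thesis using k mn by (intro exI[of _ "n - m"]) simp
qed

lemma card_rcosets_self:
  assumes H: "subgroup H G"
  shows "card (rcosets\<^bsub>G\<lparr>carrier := H\<rparr>\<^esub> H) = 1"
proof -
  interpret H: group "G\<lparr>carrier := H\<rparr>" using H by (rule subgroup.subgroup_is_group) (rule is_group)
  have "H #>\<^bsub>G\<lparr>carrier := H\<rparr>\<^esub> x = H" if "x \<in> H" for x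
    using H.coset_join2[OF _ H.subgroup_self] that by simp
  then have "rcosets\<^bsub>G\<lparr>carrier := H\<rparr>\<^esub> H = {H}"
    using subgroup.one_closed[OF H] by (auto simp: RCOSETS_def)
  then show ?thesis by simp
qed

text \<open>Induction on the construction of \<open>H\<close>. Unique roots, applied coordinatewise,
  settle the trivial subgroup and the diagonal; conjugation commutes with powers, and intersections
  inherit the property.\<close>

lemma diagonal_family_root_closed:
  assumes roots: "\<And>x y n. \<lbrakk>x \<in> carrier G; y \<in> carrier G; n > 0; x [^] (n::nat) = y [^] n\<rbrakk> \<Longrightarrow> x = y"
    and H: "H \<in> diagonal_family G"
    and p: "p \<in> carrier (G \<times>\<times> G)" and n: "n > 0" "p [^]\<^bsub>G \<times>\<times> G\<^esub> (n::nat) \<in> H"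
  shows "p \<in> H"
proof -
  interpret GG: group "G \<times>\<times> G" by (intro DirProd_group is_group)
  show ?thesis using H p n
  proof (induction arbitrary: p n)
    case (trivial p n)
    obtain a b where ab: "p = (a, b)" "a \<in> carrier G" "b \<in> carrier G" using trivial(1) by auto
    then have "a [^] n = \<one>" "b [^] n = \<one>" using trivial(3) by (simp_all add: nat_pow_DirProd)
    then show ?case
      using ab trivial(2) roots[of a \<one> n] roots[of b \<one> n] by (simp add: nat_pow_one)
  next
    case (diag p n)
    obtain a b where ab: "p = (a, b)" "a \<in> carrier G" "b \<in> carrier G" using diag(1) by auto
    then have "a [^] n = b [^] n" using diag(3) by (auto simp: nat_pow_DirProd diagonal_def)
    then have "a = b" using roots[of a b n] ab diag(2) by simp
    then show ?case using ab by (simp add: diagonal_def)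
  next
    case (conj H g p n)
    have HG: "H \<subseteq> carrier (G \<times>\<times> G)"
      using diagonal_family_subgroup[OF is_group conj.hyps(1)] by (rule subgroup.subset)
    let ?q = "inv\<^bsub>G \<times>\<times> G\<^esub> g \<otimes>\<^bsub>G \<times>\<times> G\<^esub> p \<otimes>\<^bsub>G \<times>\<times> G\<^esub> g"
    note mem_iff = GG.mem_conjugate_iff[OF HG conj.hyps(2)]
    have "?q [^]\<^bsub>G \<times>\<times> G\<^esub> n \<in> H"
      unfolding GG.nat_pow_conjugate[OF conj.hyps(2) conj.prems(1)]
      using conj.prems(3) mem_iff[OF GG.nat_pow_closed[OF conj.prems(1)]] by blast
    moreover have "?q \<in> carrier (G \<times>\<times> G)"
      by (intro GG.m_closed GG.inv_closed conj.hyps(2) conj.prems(1))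
    ultimately have "?q \<in> H" using conj.IH[of ?q n] conj.prems(2) by blast
    then show ?case using mem_iff[OF conj.prems(1)] by blast
  next
    case (inter H H' p n)
    then have "p \<in> H" "p \<in> H'" using inter.IH(1)[of p n] inter.IH(2)[of p n] by auto
    then show ?case by simp
  qed
qed

lemma principal_group_if_unique_roots:
  assumes roots: "\<And>x y n. \<lbrakk>x \<in> carrier G; y \<in> carrier G; n > 0; x [^] (n::nat) = y [^] n\<rbrakk> \<Longrightarrow> x = y"
  shows "principal_group G"
  unfolding principal_group_def
proof (intro conjI ballI is_group)
  interpret GG: group "G \<times>\<times> G" by (intro DirProd_group is_group)
  fix H H' assume H: "H \<in> diagonal_family G" and H': "H' \<in> diagonal_family G"
  have sH: "subgroup H (G \<times>\<times> G)" and sI: "subgroup (H \<inter> H') (G \<times>\<times> G)"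
    using diagonal_family_subgroup[OF is_group] diagonal_family.inter[OF H H'] H by blast+
  let ?R = "rcosets\<^bsub>(G \<times>\<times> G)\<lparr>carrier := H\<rparr>\<^esub> (H \<inter> H')"
  show "card ?R = 1 \<or> infinite ?R"
  proof (cases "finite ?R")
    case True
    have "H \<subseteq> H'"
    proof
      fix x assume x: "x \<in> H"
      obtain n :: nat where "n > 0" "x [^]\<^bsub>G \<times>\<times> G\<^esub> n \<in> H \<inter> H'"
        using GG.nat_pow_mem_of_finite_index[OF sH sI _ x True] by auto
      then show "x \<in> H'"
        using x subgroup.mem_carrier[OF sH]
        by (intro diagonal_family_root_closed[OF _ H', of x n]) (auto intro: roots)
    qed
    then have "H \<inter> H' = H" by blast
    then show ?thesis using GG.card_rcosets_self[OF sH] by simp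
  qed simp
qed

end

section \<open>Word metrics\<close>

locale finitely_generated_group = group G for G (structure) +
  fixes S
  assumes finite_generators: "finite S"
    and generators_closed: "S \<subseteq> carrier G"
    and generate_eq: "generate G S = carrier G"
begin

abbreviation letters where "letters \<equiv> S \<union> m_inv G ` S"

abbreviation word_value where "word_value w \<equiv> foldr (\<otimes>) w \<one>"

abbreviation len where "len \<equiv> word_length G S"

abbreviation dist where "dist \<equiv> word_dist G S"

lemma letters_closed: "letters \<subseteq> carrier G"
  using generators_closed by auto

lemma word_value_closed: "set w \<subseteq> letters \<Longrightarrow> word_value w \<in> carrier G"
proof (induction w)
  case (Cons a w)
  then have "a \<in> carrier G" using letters_closed by auto
  then show ?case using Cons by simp
qed simp

lemma word_value_append:
  "\<lbrakk>set u \<subseteq> letters; set v \<subseteq> letters\<rbrakk>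
    \<Longrightarrow> word_value (u @ v) = word_value u \<otimes> word_value v"
proof (induction u)
  case Nil
  then show ?case using word_value_closed by simp
next
  case (Cons a u)
  then have "a \<in> carrier G" using letters_closed by auto
  then show ?case using Cons word_value_closed by (simp add: m_assoc)
qed

lemma word_value_inv:
  "set w \<subseteq> letters
    \<Longrightarrow> set (rev (map (m_inv G) w)) \<subseteq> letters \<and>
      word_value (rev (map (m_inv G) w)) = inv (word_value w)"
proof (induction w)
  case Nil
  then show ?case by simp
next
  case (Cons a w)
  then have a: "a \<in> letters" "a \<in> carrier G" using letters_closed by auto
  have ia: "inv a \<in> letters" using a(1) generators_closed by auto
  have w: "set w \<subseteq> letters" using Cons.prems by simp
  have "word_value (rev (map (m_inv G) w) @ [inv a])
      = word_value (rev (map (m_inv G) w)) \<otimes> word_value [inv a]"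
    by (rule word_value_append) (use Cons ia in auto)
  also have "\<dots> = inv (a \<otimes> word_value w)"
    using Cons a word_value_closed[OF w] by (simp add: inv_mult_group)
  finally show ?case using Cons.IH[OF w] ia by simp
qed

text \<open>Ensures that the \<open>LEAST\<close> in \<open>word_length\<close> is attained on the
  whole carrier.\<close>

lemma exists_word:
  assumes "g \<in> carrier G"
  shows "\<exists>w. set w \<subseteq> letters \<and> word_value w = g"
proof -
  have "g \<in> generate G S" using assms generate_eq by simp
  then show ?thesis
  proof induction
    case one
    then show ?case by (intro exI[of _ "[]"]) simp
  next
    case (incl h)
    then show ?case using generators_closed by (intro exI[of _ "[h]"]) auto
  next
    case (inv h)
    then show ?case using generators_closed by (intro exI[of _ "[inv h]"]) auto
  next
    case (eng h1 h2)
    then obtain u v where "set u \<subseteq> letters" "word_value u = h1"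
      "set v \<subseteq> letters" "word_value v = h2" by auto
    then show ?case using word_value_append by (intro exI[of _ "u @ v"]) auto
  qed
qed

lemma geodesic_word:
  assumes "g \<in> carrier G"
  obtains w where "length w = len g" "set w \<subseteq> letters" "word_value w = g"
proof -
  have "\<exists>n w. length w = n \<and> set w \<subseteq> letters \<and> word_value w = g"
    using exists_word[OF assms] by blast
  then have "\<exists>w. length w = len g \<and> set w \<subseteq> letters \<and> word_value w = g"
    unfolding word_length_def by (rule LeastI_ex)
  then show thesis using that by blast
qed

lemma len_word_value_le: "set w \<subseteq> letters \<Longrightarrow> len (word_value w) \<le> length w"
  unfolding word_length_def by (rule Least_le) blast

lemma len_one [simp]: "len \<one> = 0"
  using len_word_value_le[of "[]"] by simp

lemma len_mult:
  assumes "g \<in> carrier G" "h \<in> carrier G"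
  shows "len (g \<otimes> h) \<le> len g + len h"
proof -
  obtain u where u: "length u = len g" "set u \<subseteq> letters" "word_value u = g"
    using geodesic_word assms by blast
  obtain v where v: "length v = len h" "set v \<subseteq> letters" "word_value v = h"
    using geodesic_word assms by blast
  show ?thesis using len_word_value_le[of "u @ v"] word_value_append[OF u(2) v(2)] u v by simp
qed

lemma len_inv_le:
  assumes "g \<in> carrier G"
  shows "len (inv g) \<le> len g"
proof -
  obtain u where u: "length u = len g" "set u \<subseteq> letters" "word_value u = g"
    using geodesic_word assms by blast
  show ?thesis using len_word_value_le word_value_inv[OF u(2)] u by (metis length_map length_rev)
qed

lemma len_inv [simp]: "g \<in> carrier G \<Longrightarrow> len (inv g) = len g"
  using len_inv_le[of g] len_inv_le[of "inv g"] by simp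

text \<open>Only finitely many words have bounded length. Balls later supply the counting constant
  and the finite set of coset representatives.\<close>

lemma finite_ball: "finite {g \<in> carrier G. len g \<le> n}"
proof (rule finite_subset)
  show "{g \<in> carrier G. len g \<le> n} \<subseteq> word_value ` {w. set w \<subseteq> letters \<and> length w \<le> n}"
  proof
    fix g assume "g \<in> {g \<in> carrier G. len g \<le> n}"
    then have g: "g \<in> carrier G" "len g \<le> n" by auto
    then show "g \<in> word_value ` {w. set w \<subseteq> letters \<and> length w \<le> n}"
      using geodesic_word[OF g(1)] by (metis (mono_tags, lifting) image_eqI mem_Collect_eq)
  qed
  have "finite letters" using finite_generators by simp
  then show "finite (word_value ` {w. set w \<subseteq> letters \<and> length w \<le> n})"
    by (intro finite_imageI finite_lists_length_le)
qed

lemma dist_sym: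
  assumes "g \<in> carrier G" "h \<in> carrier G"
  shows "dist g h = dist h g"
  using len_inv[of "inv g \<otimes> h"] assms by (simp add: word_dist_def inv_mult_group)

lemma dist_triangle:
  assumes "g \<in> carrier G" "h \<in> carrier G" "k \<in> carrier G"
  shows "dist g k \<le> dist g h + dist h k"
proof -
  have "(inv g \<otimes> h) \<otimes> (inv h \<otimes> k) = inv g \<otimes> k"
    using assms by (simp add: m_assoc flip: m_assoc[of h "inv h" k])
  then show ?thesis using len_mult[of "inv g \<otimes> h" "inv h \<otimes> k"] assms
    by (simp add: word_dist_def)
qed

lemma dist_translate:
  assumes "g \<in> carrier G" "h \<in> carrier G" "k \<in> carrier G"
  shows "dist (k \<otimes> g) (k \<otimes> h) = dist g h"
proof -
  have "inv (k \<otimes> g) \<otimes> (k \<otimes> h) = inv g \<otimes> h"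
    using assms by (simp add: inv_mult_group m_assoc flip: m_assoc[of "inv k" k h])
  then show ?thesis by (simp add: word_dist_def)
qed

lemma dist_one_left: "g \<in> carrier G \<Longrightarrow> dist \<one> g = len g"
  by (simp add: word_dist_def)

lemma dist_one_right: "g \<in> carrier G \<Longrightarrow> dist g \<one> = len g"
  by (simp add: word_dist_def)

text \<open>Cut a shortest word for \<open>g\<close> after \<open>t\<close> letters. The two pieces
  bound both distances from above, and the triangle inequality makes the bounds equalities.\<close>

lemma exists_geodesic_point:
  assumes g: "g \<in> carrier G" and t: "t \<le> len g"
  shows "\<exists>p\<in>carrier G. dist \<one> p = t \<and> dist p g = real (len g) - t"
proof -
  obtain w where w: "length w = len g" "set w \<subseteq> letters" "word_value w = g"
    using geodesic_word[OF g] by blast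
  let ?u = "take t w" and ?v = "drop t w"
  have u: "set ?u \<subseteq> letters" and v: "set ?v \<subseteq> letters"
    using w(2) set_take_subset[of t w] set_drop_subset[of t w] by auto
  let ?p = "word_value ?u"
  have p: "?p \<in> carrier G" using word_value_closed[OF u] .
  have "?p \<otimes> word_value ?v = g" using word_value_append[OF u v] w(3) by simp
  then have "inv ?p \<otimes> g = word_value ?v"
    using p word_value_closed[OF v] g inv_solve_left' by metis
  then have "dist ?p g \<le> real (len g) - t"
    using len_word_value_le[OF v] w(1) t by (simp add: word_dist_def of_nat_diff)
  moreover have "dist \<one> ?p \<le> t"
    using len_word_value_le[OF u] p by (simp add: dist_one_left)
  moreover have "len g \<le> dist \<one> ?p + dist ?p g"
    using dist_triangle[of \<one> ?p g] p g by (simp add: dist_one_left)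
  ultimately show ?thesis using p by (intro bexI[of _ ?p]) auto
qed

end

section \<open>Hyperbolicity\<close>

locale hyperbolic_fg_group = finitely_generated_group +
  fixes \<delta> :: real
  assumes \<delta>_nonneg: "\<delta> \<ge> 0"
    and gromov: "\<And>p x y z. \<lbrakk>p \<in> carrier G; x \<in> carrier G; y \<in> carrier G; z \<in> carrier G\<rbrakk> \<Longrightarrow>
      gromov_product (word_dist G S) p x z
        \<ge> min (gromov_product (word_dist G S) p x y) (gromov_product (word_dist G S) p y z) - \<delta>"
begin

text \<open>The Gromov product inequality with the products expanded; the factor 2 clears their
  denominator.\<close>

lemma four_point:
  assumes "p \<in> carrier G" "x \<in> carrier G" "y \<in> carrier G" "z \<in> carrier G"
  shows "dist x z + dist y p \<le> max (dist x y + dist z p) (dist y z + dist x p) + 2 * \<delta>"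
  using gromov[OF assms] assms
  by (simp add: gromov_product_def dist_sym min_def max_def field_simps split: if_splits)

text \<open>Replace the endpoints \<open>x'\<close> and \<open>y'\<close> by \<open>x\<close> and
  \<open>y\<close> one at a time, losing 2\<delta> each time. The distances in \<open>far\<close>
  rule out the unwanted branch of each maximum; the second threshold also absorbs the first
  loss.\<close>

lemma near_geodesic:
  assumes G: "x \<in> carrier G" "y \<in> carrier G" "x' \<in> carrier G" "y' \<in> carrier G" "q \<in> carrier G"
    and ends: "dist x x' \<le> r" "dist y y' \<le> r"
    and q: "dist x' q + dist q y' = dist x' y'"
    and far: "dist x' q > r + 2 * \<delta>" "dist y' q > r + 4 * \<delta>"
  shows "dist x q + dist q y \<le> dist x y + 4 * \<delta>"
proof -
  note sym = dist_sym[OF G(3,1)] dist_sym[OF G(5,1)] dist_sym[OF G(5,2)] dist_sym[OF G(5,4)]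
    dist_sym[OF G(4,2)]
  have "dist x' y' + dist x q \<le> max (dist x' x + dist y' q) (dist x y' + dist x' q) + 2 * \<delta>"
    by (rule four_point) (use G in auto)
  then have 1: "dist x q + dist q y' \<le> dist x y' + 2 * \<delta>"
    using ends q far sym \<delta>_nonneg dist_triangle[of x' x q] dist_triangle[of x x' q] G by auto
  have "dist x y' + dist y q \<le> max (dist x y + dist y' q) (dist y y' + dist x q) + 2 * \<delta>"
    by (rule four_point) (use G in auto)
  moreover have "dist y' q \<le> dist y' y + dist y q" using dist_triangle G by blast
  ultimately show ?thesis
    using 1 ends far sym \<delta>_nonneg by auto
qed

text \<open>One four-point inequality for \<open>x\<close>, \<open>q\<close>, \<open>y\<close>,
  \<open>m\<close>: the excess 4\<delta> of \<open>q\<close> plus the loss 2\<delta> gives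
  6\<delta>.\<close>

lemma close_to_geodesic_point:
  assumes G: "x \<in> carrier G" "y \<in> carrier G" "m \<in> carrier G" "q \<in> carrier G"
    and m: "dist x m + dist m y = dist x y" "dist x m = dist x q"
    and q: "dist x q + dist q y \<le> dist x y + 4 * \<delta>"
  shows "dist m q \<le> 6 * \<delta>"
proof -
  have "dist x y + dist q m \<le> max (dist x q + dist y m) (dist q y + dist x m) + 2 * \<delta>"
    by (rule four_point) (use G in auto)
  then show ?thesis
    using m q dist_sym[OF G(3,4)] dist_sym[OF G(2,3)] \<delta>_nonneg by auto
qed

section \<open>Growth of the lengths of powers\<close>

lemma exists_long_power:
  assumes g: "g \<in> carrier G" and inj: "inj (\<lambda>n::nat. g [^] n)"
  shows "\<exists>n::nat. len (g [^] n) > l"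
proof (rule ccontr)
  assume "\<not> ?thesis"
  then have "range (\<lambda>n::nat. g [^] n) \<subseteq> {h \<in> carrier G. len h \<le> l}"
    using g by (auto simp: not_less)
  then show False
    using finite_ball finite_subset range_inj_infinite[OF inj] by blast
qed

text \<open>
  Powers \<open>g\<^sup>i\<close> of small length move the middle of a long geodesic from \<open>1\<close> to \<open>g\<^sup>N\<close> to points
  near that geodesic, and there is only linearly much room for these points.
\<close>

lemma powers_linear_growth:
  assumes g: "g \<in> carrier G" and inj: "inj (\<lambda>n::nat. g [^] n)"
    and r: "\<And>i::nat. i \<le> M \<Longrightarrow> len (g [^] i) \<le> r"
  shows "M + 1 \<le> (2 * r + 1) * card {b \<in> carrier G. len b \<le> nat \<lfloor>6 * \<delta>\<rfloor>}"
proof -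
  \<comment> \<open>Large enough for \<open>near_geodesic\<close> at the near end; the later choice
    \<open>2 * t < D\<close> gives the same room at the far end.\<close>
  define t where "t = r + nat \<lceil>4 * \<delta>\<rceil> + 1"
  obtain N :: nat where N: "len (g [^] N) > 2 * t" using exists_long_power[OF g inj] by blast
  define y where "y = g [^] N"
  define D where "D = len y"
  have yG: "y \<in> carrier G" using g by (simp add: y_def)
  have "\<exists>p. \<forall>k\<le>D. p k \<in> carrier G \<and> dist \<one> (p k) = k \<and> dist (p k) y = real D - k"
    using exists_geodesic_point[OF yG] unfolding D_def by (intro choice) blast
  then obtain p where pG: "\<And>k. k \<le> D \<Longrightarrow> p k \<in> carrier G"
    and p1: "\<And>k. k \<le> D \<Longrightarrow> dist \<one> (p k) = k"
    and py: "\<And>k. k \<le> D \<Longrightarrow> dist (p k) y = real D - k" by blast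
  have tD: "2 * t < D" using N by (simp add: D_def y_def)
  then have ptG: "p t \<in> carrier G" using pG by simp
  define q where "q i = g [^] i \<otimes> p t" for i :: nat
  \<comment> \<open>The pair records a position on the geodesic and the offset of \<open>q i\<close>
    from the point there. It determines \<open>q i\<close>, hence \<open>i\<close>.\<close>
  define F where "F i = (len (q i), inv (p (len (q i))) \<otimes> q i)" for i
  have qG: "q i \<in> carrier G" for i using g ptG by (simp add: q_def)
  have q_len: "len (q i) \<le> t + r \<and> t \<le> len (q i) + r \<and> dist (p (len (q i))) (q i) \<le> 6 * \<delta>"
    if i: "i \<le> M" for i
  proof -
    define x' where "x' = g [^] i"
    have x'G: "x' \<in> carrier G" using g by (simp add: x'_def)
    define y' where "y' = x' \<otimes> y"
    have y'G: "y' \<in> carrier G" using x'G yG by (simp add: y'_def)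
    \<comment> \<open>Powers of \<open>g\<close> commute, so left translation by \<open>x'\<close>
      moves \<open>y\<close> only by the length of \<open>x'\<close>.\<close>
    have y': "y' = y \<otimes> x'" using g by (simp add: y'_def y_def x'_def nat_pow_comm)
    have ends: "dist \<one> x' \<le> r" "dist y y' \<le> r"
      using r[OF i] dist_translate[of \<one> x' y] x'G yG
      by (simp_all add: dist_one_left y' x'_def[symmetric])
    have x'q: "dist x' (q i) = t"
      using dist_translate[of \<one> "p t" x'] p1[of t] x'G ptG tD by (simp add: q_def x'_def)
    have qy': "dist (q i) y' = real D - t"
      using dist_translate[of "p t" y x'] py[of t] x'G ptG yG tD by (simp add: q_def y'_def x'_def)
    have x'y': "dist x' y' = D"
      using dist_translate[of \<one> y x'] x'G yG by (simp add: y'_def dist_one_left D_def)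
    have len_q: "dist \<one> (q i) = len (q i)" using qG by (simp add: dist_one_left)
    have t: "real t > real r + 4 * \<delta>" unfolding t_def by linarith
    have "dist \<one> (q i) + dist (q i) y \<le> dist \<one> y + 4 * \<delta>"
    proof (rule near_geodesic[OF _ yG x'G y'G qG ends])
      show "dist x' (q i) + dist (q i) y' = dist x' y'" using x'q qy' x'y' by simp
      show "real r + 2 * \<delta> < dist x' (q i)" using x'q t \<delta>_nonneg by simp
      show "real r + 4 * \<delta> < dist y' (q i)"
        using qy' dist_sym[OF y'G qG] t tD by simp
    qed simp
    note near = this
    have bounds: "len (q i) \<le> t + r" "t \<le> len (q i) + r"
    proof -
      have "dist \<one> (q i) \<le> dist \<one> x' + dist x' (q i)" using dist_triangle x'G qG by simp
      then show "len (q i) \<le> t + r" using ends(1) x'q len_q by simp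
      have "dist x' (q i) \<le> dist x' \<one> + dist \<one> (q i)" using dist_triangle x'G qG by simp
      then show "t \<le> len (q i) + r" using ends(1) x'q len_q dist_sym[OF x'G one_closed] by simp
    qed
    \<comment> \<open>As \<open>r < t\<close>, the bound \<open>t + r\<close> stays below
      \<open>2 * t < D\<close>, so the geodesic has a point at this position.\<close>
    then have D: "len (q i) \<le> D" using tD t_def by linarith
    have "dist (p (len (q i))) (q i) \<le> 6 * \<delta>"
    proof (rule close_to_geodesic_point[OF one_closed yG pG[OF D] qG _ _ near])
      show "dist \<one> (p (len (q i))) + dist (p (len (q i))) y = dist \<one> y"
        using p1[OF D] py[OF D] yG by (simp add: dist_one_left D_def)
      show "dist \<one> (p (len (q i))) = dist \<one> (q i)" using p1[OF D] len_q by simp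
    qed
    then show ?thesis using bounds by blast
  qed
  have q_le_D: "len (q i) \<le> D" if "i \<le> M" for i
    using q_len[OF that] tD t_def by linarith
  have "inj_on F {..M}"
  proof (rule inj_onI)
    fix i j assume ij: "i \<in> {..M}" "j \<in> {..M}" and eq: "F i = F j"
    have "inv (p (len (q i))) \<otimes> q i = inv (p (len (q i))) \<otimes> q j"
      using eq by (metis F_def prod.inject)
    then have "q i = q j" using qG pG q_le_D ij by simp
    then have "g [^] i = g [^] j" using g ptG by (simp add: q_def)
    then show "i = j" using inj by (auto dest: injD)
  qed
  moreover have "F ` {..M} \<subseteq> {t - r..t + r} \<times> {b \<in> carrier G. len b \<le> nat \<lfloor>6 * \<delta>\<rfloor>}"
  proof (rule image_subsetI)
    fix i assume "i \<in> {..M}"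
    then have i: "i \<le> M" by simp
    have "len (inv (p (len (q i))) \<otimes> q i) \<le> nat \<lfloor>6 * \<delta>\<rfloor>"
      using q_len[OF i] by (simp add: word_dist_def le_nat_floor)
    then show "F i \<in> {t - r..t + r} \<times> {b \<in> carrier G. len b \<le> nat \<lfloor>6 * \<delta>\<rfloor>}"
      using q_len[OF i] pG q_le_D[OF i] qG by (auto simp: F_def)
  qed
  ultimately have "card {..M} \<le> card ({t - r..t + r} \<times> {b \<in> carrier G. len b \<le> nat \<lfloor>6 * \<delta>\<rfloor>})"
    using finite_ball by (intro card_inj_on_le) auto
  \<comment> \<open>Since \<open>t > r\<close>, the subtraction \<open>t - r\<close> is not
    truncated and the interval has exactly \<open>2 * r + 1\<close> elements.\<close>
  also have "\<dots> = (2 * r + 1) * card {b \<in> carrier G. len b \<le> nat \<lfloor>6 * \<delta>\<rfloor>}"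
    by (simp add: t_def card_cartesian_product)
  finally show ?thesis by simp
qed

text \<open>Otherwise the length of \<open>g\<^sup>n\<close> would grow at most logarithmically.\<close>

lemma exists_power_doubling:
  assumes g: "g \<in> carrier G" and inj: "inj (\<lambda>n::nat. g [^] n)"
  shows "\<exists>k::nat. real (len (g [^] (2 * k))) > len (g [^] k) + 4 * \<delta>"
proof (rule ccontr)
  assume "\<not> ?thesis"
  then have dbl: "real (len (g [^] (2 * k))) \<le> len (g [^] k) + 4 * \<delta>" for k :: nat
    by (simp add: not_less)
  \<comment> \<open>Cost of one binary digit of the exponent: 4\<delta> for doubling and
    \<open>len g\<close> for a digit one.\<close>
  define C where "C = 4 * \<delta> + len g"
  have C: "C \<ge> 0" using \<delta>_nonneg by (simp add: C_def)
  have log: "real (len (g [^] i)) \<le> C * m" if "i < 2 ^ m" for i m :: nat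
    using that
  proof (induction m arbitrary: i)
    case 0
    then show ?case by simp
  next
    case (Suc m)
    define j where "j = i div 2"
    have "real (len (g [^] j)) \<le> C * m" using Suc by (intro Suc.IH) (auto simp: j_def)
    then have j: "real (len (g [^] (2 * j))) \<le> C * m + 4 * \<delta>" using dbl[of j] by linarith
    consider "i = 2 * j" | "i = Suc (2 * j)" unfolding j_def by linarith
    then show ?case
    proof cases
      case 1
      then show ?thesis using j by (simp add: C_def algebra_simps)
    next
      case 2
      have "len (g [^] i) \<le> len (g [^] (2 * j)) + len g"
        using len_mult[of "g [^] (2 * j)" g] g 2 by simp
      then show ?thesis using j by (simp add: C_def algebra_simps)
    qed
  qed
  define B where "B = card {b \<in> carrier G. len b \<le> nat \<lfloor>6 * \<delta>\<rfloor>}"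
  have bound: "2 ^ m \<le> (2 * (C * m) + 1) * B" for m :: nat
  proof -
    \<comment> \<open>Linear growth for the \<open>2 ^ m\<close> exponents below
      \<open>2 ^ m\<close>, all of length at most \<open>C * m\<close>.\<close>
    have "(2 ^ m - 1) + 1 \<le> (2 * nat \<lfloor>C * m\<rfloor> + 1) * B"
      unfolding B_def
    proof (rule powers_linear_growth[OF g inj])
      fix i :: nat assume "i \<le> 2 ^ m - 1"
      moreover have "(0::nat) < 2 ^ m" by simp
      ultimately have "i < 2 ^ m" by linarith
      then show "len (g [^] i) \<le> nat \<lfloor>C * m\<rfloor>" using log by (simp add: le_nat_floor)
    qed
    then have "real (2 ^ m) \<le> real ((2 * nat \<lfloor>C * m\<rfloor> + 1) * B)"
      using of_nat_mono by fastforce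
    also have "\<dots> = (2 * real (nat \<lfloor>C * m\<rfloor>) + 1) * B" by (simp add: algebra_simps)
    also have "\<dots> \<le> (2 * (C * m) + 1) * B"
      using C by (intro mult_right_mono add_right_mono mult_left_mono of_nat_floor) auto
    finally show ?thesis by simp
  qed
  \<comment> \<open>After division by \<open>2 ^ m\<close> the right side tends to 0, while the left
    side is 1.\<close>
  have "1 \<le> 2 * C * B * (real m * (1 / 2) ^ m) + B * (1 / 2) ^ m" for m :: nat
    using bound[of m] by (simp add: field_simps)
  moreover have "(\<lambda>m. 2 * C * B * (real m * (1 / 2) ^ m) + B * (1 / 2) ^ m)
      \<longlonglongrightarrow> 2 * C * B * 0 + real B * 0"
    by (intro tendsto_add tendsto_mult[OF tendsto_const] powser_times_n_limit_0 LIMSEQ_power_zero)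
      simp_all
  ultimately have "1 \<le> 2 * C * B * 0 + real B * 0"
    by (intro LIMSEQ_le_const) auto
  then show False by simp
qed

section \<open>Centralisers and uniqueness of roots\<close>

text \<open>The four-point condition applied to \<open>1, u, u\<^sup>-\<^sup>1, h\<close> and to the parallelogram \<open>1, u, h, uh\<close>.\<close>

lemma len_minimal_commuting_less:
  assumes u: "u \<in> carrier G" and h: "h \<in> carrier G" and comm: "u \<otimes> h = h \<otimes> u"
    and dbl: "real (len (u \<otimes> u)) > len u + 4 * \<delta>"
    and min: "len h \<le> len (u \<otimes> h)" "len h \<le> len (inv u \<otimes> h)"
  shows "len h < len u"
proof -
  have iu: "inv u \<in> carrier G" using u by simp
  have uh: "u \<otimes> h \<in> carrier G" using u h by simp
  have 1: "dist u (inv u) = len (u \<otimes> u)"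
    using len_inv[of "u \<otimes> u"] u by (simp add: word_dist_def inv_mult_group)
  have 2: "dist (inv u) h = len (u \<otimes> h)" using u by (simp add: word_dist_def)
  have 3: "dist h (u \<otimes> h) = len u"
    using dist_translate[of \<one> u h] u h comm by (simp add: dist_one_left)
  have 4: "dist u (u \<otimes> h) = len h"
    using dist_translate[of \<one> h u] u h by (simp add: dist_one_left)
  have 5: "dist u h = len (inv u \<otimes> h)" by (simp add: word_dist_def)
  have "dist u (inv u) + dist h \<one> \<le> max (dist u h + dist (inv u) \<one>) (dist h (inv u) + dist u \<one>) + 2 * \<delta>"
    by (rule four_point) (use u h in auto)
  \<comment> \<open>By the first inequality and \<open>dbl\<close>, one of
    \<open>u \<otimes> h\<close> and \<open>inv u \<otimes> h\<close> is longer than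
    \<open>len h + 2 * \<delta>\<close>; the other has length at least \<open>len h\<close>. Their
    lengths add up to more than \<open>2 * len h + 2 * \<delta>\<close>, so the maximum in the
    second inequality must be \<open>2 * len u\<close>, with \<open>len u > len h\<close>.\<close>
  moreover have "dist \<one> (u \<otimes> h) + dist h u \<le> max (dist \<one> h + dist (u \<otimes> h) u) (dist h (u \<otimes> h) + dist \<one> u) + 2 * \<delta>"
    by (rule four_point) (use u h in auto)
  ultimately show ?thesis
    using 1 2 3 4 5 dbl min u h uh iu dist_sym[OF h u] dist_sym[OF h iu] dist_sym[OF uh u]
    by (simp add: dist_one_left dist_one_right)
qed

lemma torsion_free_unique_roots:
  assumes tf: "torsion_free G" and x: "x \<in> carrier G" and y: "y \<in> carrier G"
    and n: "n > 0" and eq: "x [^] (n::nat) = y [^] n"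
  shows "x = y"
proof (cases "x [^] n = \<one>")
  case True
  then show ?thesis using torsion_freeD[OF tf x True n] torsion_freeD[OF tf y _ n] eq by simp
next
  case False
  define g where "g = x [^] n"
  have g: "g \<in> carrier G" "g \<noteq> \<one>" using False x by (simp_all add: g_def)
  obtain k :: nat where k: "real (len (g [^] (2 * k))) > len (g [^] k) + 4 * \<delta>"
    using exists_power_doubling torsion_free_inj_nat_pow tf g by blast
  define u where "u = g [^] k"
  have u: "u \<in> carrier G" using g by (simp add: u_def)
  have dbl: "real (len (u \<otimes> u)) > len u + 4 * \<delta>"
    using k g by (simp add: u_def nat_pow_mult mult_2)
  \<comment> \<open>For \<open>u = \<one>\<close> the strict inequality \<open>dbl\<close> would
    read \<open>0 > 4 * \<delta>\<close>.\<close>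
  have "u \<noteq> \<one>" using dbl \<delta>_nonneg by auto
  define C where "C = {z \<in> carrier G. z \<otimes> u = u \<otimes> z}"
  have C: "subgroup C G" unfolding C_def by (rule subgroup_centralizer[OF u])
  interpret C: group "G\<lparr>carrier := C\<rparr>" using C by (rule subgroup.subgroup_is_group) (rule is_group)
  have uC: "u \<in> C" using u by (simp add: C_def)
  \<comment> \<open>An \<open>n\<close>-th root of \<open>g\<close> commutes with \<open>g\<close>,
    hence with its power \<open>u\<close>.\<close>
  have "z \<otimes> u = u \<otimes> z" if "z \<in> carrier G" "z [^] n = g" for z
  proof -
    have "g \<otimes> z = z \<otimes> g" using group_commutes_pow[of z z n] that by simp
    then show ?thesis using group_commutes_pow[of g z k] that(1) g by (simp add: u_def)
  qed
  then have "x \<in> C" "y \<in> C" using x y eq by (auto simp: C_def g_def)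
  have "x \<otimes>\<^bsub>G\<lparr>carrier := C\<rparr>\<^esub> y = y \<otimes>\<^bsub>G\<lparr>carrier := C\<rparr>\<^esub> x"
  proof (rule C.torsion_free_central_cyclic_finite_index_comm)
    show "torsion_free (G\<lparr>carrier := C\<rparr>)"
      using tf subgroup.mem_carrier[OF C] by (auto simp: torsion_free_def simp flip: nat_pow_consistent)
    let ?F = "{z \<in> C. len z \<le> len u}"
    show "finite ?F" by (rule finite_subset[OF _ finite_ball[of "len u"]]) (auto simp: C_def)
    show "\<exists>f\<in>?F. \<exists>j::int. z = f \<otimes>\<^bsub>G\<lparr>carrier := C\<rparr>\<^esub> u [^]\<^bsub>G\<lparr>carrier := C\<rparr>\<^esub> j"
      if "z \<in> carrier (G\<lparr>carrier := C\<rparr>)" for z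
    proof -
      have z: "z \<in> C" "z \<in> carrier G" using that by (auto simp: C_def)
      \<comment> \<open>Lengths are natural numbers, so the coset of \<open>z\<close> has a shortest
        element \<open>h\<close>. Comparing \<open>h\<close> with its neighbours at exponents
        \<open>i + 1\<close> and \<open>i - 1\<close> bounds it by \<open>len u\<close>.\<close>
      obtain i :: int where i: "\<And>j::int. len (u [^] i \<otimes> z) \<le> len (u [^] j \<otimes> z)"
        using ex_has_least_nat[of "\<lambda>_. True" _ "\<lambda>j::int. len (u [^] j \<otimes> z)"] by blast
      define h where "h = u [^] i \<otimes> z"
      have uiC: "u [^] i \<in> C" by (rule subgroup_int_pow_closed[OF C uC])
      have hC: "h \<in> C" unfolding h_def by (rule subgroup.m_closed[OF C uiC z(1)])
      then have h: "h \<in> carrier G" "u \<otimes> h = h \<otimes> u" by (simp_all add: C_def)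
      have "u \<otimes> h = u [^] (1 + i) \<otimes> z" "inv u \<otimes> h = u [^] (-1 + i) \<otimes> z"
        using u z int_pow_mult[of u 1 i] int_pow_mult[of u "-1" i] int_pow_neg[of u 1]
        by (simp_all add: h_def m_assoc)
      then have "len h < len u"
        using len_minimal_commuting_less[OF u h dbl] i unfolding h_def by metis
      moreover have "z = h \<otimes> u [^] (- i)"
      proof -
        have "u [^] i \<otimes> z = z \<otimes> u [^] i" using int_pow_commute[OF u z(2)] z(1) by (simp add: C_def)
        then show ?thesis using u z by (simp add: h_def int_pow_neg m_assoc)
      qed
      ultimately show ?thesis
        using hC int_pow_consistent[OF C uC, of "- i"] by auto
    qed
  qed (use u uC \<open>u \<noteq> \<one>\<close> \<open>x \<in> C\<close> \<open>y \<in> C\<close> in \<open>auto simp: C_def\<close>)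
  \<comment> \<open>Commutation is passed on to \<open>inv y\<close>, so that the
    \<open>n\<close>-th power distributes over \<open>x \<otimes> inv y\<close>.\<close>
  then have "y \<in> {z \<in> carrier G. z \<otimes> x = x \<otimes> z}" using y by simp
  then have "inv y \<in> {z \<in> carrier G. z \<otimes> x = x \<otimes> z}"
    by (rule subgroup.m_inv_closed[OF subgroup_centralizer[OF x]])
  then have "(x \<otimes> inv y) [^] n = x [^] n \<otimes> inv y [^] n"
    using x y by (intro pow_mult_distrib) auto
  also have "\<dots> = \<one>" using x y eq by (simp add: nat_pow_inv)
  finally have "x \<otimes> inv y = \<one>" using torsion_freeD[OF tf _ _ n] x y by simp
  then show ?thesis using inv_solve_right'[of \<one> x y] x y by simp
qed

end

theorem corollary8p0p6:
  fixes G :: "('a, 'b) monoid_scheme"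
  assumes "hyperbolic_group G" and "torsion_free G"
  shows "principal_group G"
proof -
  obtain S where G: "group G"
    and S: "finite S" "S \<subseteq> carrier G" "generate G S = carrier G"
      "gromov_hyperbolic (carrier G) (word_dist G S)"
    using assms(1) unfolding hyperbolic_group_def by blast
  interpret group G by (rule G)
  obtain \<delta> where \<delta>: "\<delta> \<ge> 0" "\<forall>p\<in>carrier G. \<forall>x\<in>carrier G. \<forall>y\<in>carrier G. \<forall>z\<in>carrier G.
      gromov_product (word_dist G S) p x z
        \<ge> min (gromov_product (word_dist G S) p x y) (gromov_product (word_dist G S) p y z) - \<delta>"
    using S(4) unfolding gromov_hyperbolic_def by blast
  interpret hyperbolic_fg_group G S \<delta>
    using S \<delta> by unfold_locales auto
  show ?thesis
    using principal_group_if_unique_roots torsion_free_unique_roots[OF assms(2)] by blast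
qed

end
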